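(* For every $\xi>0$ there is $m_0$ such that for every $m\ge m_0$ the following holds: every $m$-partite graph $G$ with nonempty vertex classes $V_1,\dots,V_m$ such that for all $1\le i<j\le m$ the bipartite graph $G[V_i,V_j]$, with ordered bipartition $(V_i,V_j)$, is $\xi$-rich, contains a triangle.
   Context: Let $\xi>0$ and let $G$ be a bipartite graph with fixed ordered bipartition $(X,Y)$. For $y\in Y$, the number of two-edge walks starting at $y$ is $\sum_{x\in N(y)}\deg(x)$ (walks $yxy'$ with $xy,xy'\in E(G)$, allowing $y'=y$). $G$ is $\xi$-poor if there are at most $\xi|Y|$ vertices $y\in Y$ for which the number of two-edge walks starting at $y$ is larger than $(\frac14+\xi)|X||Y|$; otherwise $G$ is $\xi$-rich. *)

theory Defs
  imports Complex_Main "HOL-Library.Disjoint_Sets" "Graph_Theory.Pair_Digraph"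
begin

text \<open>
  A finite simple graph is a \<^locale>\<open>pair_graph\<close>: finite, loop-free, and with a symmetric arc set,
  so that an edge \<open>uv\<close> is the pair of arcs \<open>(u, v)\<close>, \<open>(v, u)\<close>, and the degree of a vertex
  is its out-degree.
\<close>

definition nbhd :: "'a pair_pre_digraph \<Rightarrow> 'a \<Rightarrow> 'a set" where
  "nbhd G v = {u. (v, u) \<in> parcs G}"

definition degree :: "'a pair_pre_digraph \<Rightarrow> 'a \<Rightarrow> nat" where
  "degree G v = out_degree (with_proj G) v"

definition bipartite_between :: "'a pair_pre_digraph \<Rightarrow> 'a set \<Rightarrow> 'a set \<Rightarrow> 'a pair_pre_digraph" where
  "bipartite_between G X Y =
     \<lparr> pverts = X \<union> Y, parcs = parcs G \<inter> (X \<times> Y \<union> Y \<times> X) \<rparr>"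

definition two_edge_walks :: "'a pair_pre_digraph \<Rightarrow> 'a \<Rightarrow> nat" where
  "two_edge_walks G y = (\<Sum>x\<in>nbhd G y. degree G x)"

text \<open>In the next two definitions \<open>(X, Y)\<close> is the ordered bipartition of the bipartite graph \<open>G\<close>.\<close>

definition poor :: "real \<Rightarrow> 'a pair_pre_digraph \<Rightarrow> 'a set \<Rightarrow> 'a set \<Rightarrow> bool" where
  "poor \<xi> G X Y \<longleftrightarrow>
     real (card {y \<in> Y. real (two_edge_walks G y) > (1/4 + \<xi>) * real (card X) * real (card Y)})
       \<le> \<xi> * real (card Y)"

definition rich :: "real \<Rightarrow> 'a pair_pre_digraph \<Rightarrow> 'a set \<Rightarrow> 'a set \<Rightarrow> bool" where
  "rich \<xi> G X Y \<longleftrightarrow> \<not> poor \<xi> G X Y"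

definition multipartite :: "nat \<Rightarrow> 'a pair_pre_digraph \<Rightarrow> (nat \<Rightarrow> 'a set) \<Rightarrow> bool" where
  "multipartite m G V \<longleftrightarrow>
     (\<Union>i\<in>{1..m}. V i) = pverts G \<and> disjoint_family_on V {1..m} \<and>
     (\<forall>i\<in>{1..m}. \<forall>u\<in>V i. \<forall>v\<in>V i. (u, v) \<notin> parcs G)"

definition has_triangle :: "'a pair_pre_digraph \<Rightarrow> bool" where
  "has_triangle G \<longleftrightarrow> (\<exists>a b c. (a, b) \<in> parcs G \<and> (b, c) \<in> parcs G \<and> (a, c) \<in> parcs G)"

lemma degree_eq_card_nbhd: "degree G v = card (nbhd G v)"
proof -
  have "out_arcs (with_proj G) v = Pair v ` nbhd G v"
    by (auto simp: out_arcs_def nbhd_def)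
  then show ?thesis
    by (simp add: degree_def out_degree_def card_image inj_on_def)
qed

lemma two_edge_walks_eq_card:
  assumes "pair_graph G"
  shows "two_edge_walks G y = card {(x, y'). (y, x) \<in> parcs G \<and> (x, y') \<in> parcs G}"
proof -
  interpret pair_graph G by fact
  have fin: "finite (nbhd G v)" for v
    by (rule finite_subset[OF _ pair_finite_verts]) (auto simp: nbhd_def dest: arc_snd_in_verts)
  have "{(x, y'). (y, x) \<in> parcs G \<and> (x, y') \<in> parcs G} = (SIGMA x:nbhd G y. nbhd G x)"
    by (auto simp: nbhd_def)
  then show ?thesis
    using fin by (simp add: two_edge_walks_def degree_eq_card_nbhd)
qed

lemma pair_graph_bipartite_between:
  assumes "pair_graph G" "X \<subseteq> pverts G" "Y \<subseteq> pverts G"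
  shows "pair_graph (bipartite_between G X Y)"
proof -
  interpret pair_graph G by fact
  have "sym (parcs G)"
    using pair_sym_arcs by (simp add: symmetric_def)
  then have "sym (parcs G \<inter> (X \<times> Y \<union> Y \<times> X))"
    by (auto simp: sym_def)
  then show ?thesis
    using assms(2,3) pair_finite_verts pair_finite_arcs
    by unfold_locales
      (auto simp: bipartite_between_def symmetric_def dest: pair_no_loops intro: finite_subset)
qed

end

theory Submission
  imports Defs "HOL-Library.FuncSet"
begin

text \<open>
  Suppose \<open>G\<close> has no triangle. Going down from the last class, pick vertices \<open>y\<^sub>k \<in> V\<^sub>k\<close> and thin out
  the smaller indices so that \<open>y\<^sub>k\<close> starts more than \<open>(1/4 + \<xi>)|V\<^sub>i||V\<^sub>k|\<close> two-edge walks through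
  every surviving \<open>V\<^sub>i\<close> and its relative degree into every surviving \<open>V\<^sub>i\<close> is about the same number;
  by pigeonhole this number is some \<open>a\<close> independent of \<open>k\<close>. Fix the smallest surviving \<open>i\<close>, and let
  \<open>B\<^sub>j\<close> be the set of neighbours of \<open>y\<^sub>j\<close> in \<open>V\<^sub>i\<close> whose relative degree into \<open>V\<^sub>j\<close> exceeds \<open>1 - a\<close>.
  As \<open>a(1 - a) \<le> 1/4\<close>, every \<open>B\<^sub>j\<close> contains a positive proportion of \<open>V\<^sub>i\<close>. For \<open>j < k\<close> a vertex of
  \<open>B\<^sub>j \<inter> B\<^sub>k\<close> is adjacent to \<open>y\<^sub>k\<close>, so in \<open>V\<^sub>j\<close> its neighbourhood is disjoint from that of \<open>y\<^sub>k\<close>, and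
  has proportion at most \<open>1 - a\<close>. Hence the \<open>B\<^sub>j\<close> are pairwise disjoint, and there are boundedly many.
\<close>

text \<open>Double counting of the pairs \<open>(w, i)\<close> with \<open>R w i\<close>: if every
  \<open>w\<close> fell short, the total would be below
  \<open>\<eta> * card T * card W\<close>.\<close>

lemma ex_element_in_many_sets:
  fixes \<eta> :: real
  assumes "finite W" "finite T" "W \<noteq> {}"
    and many: "\<And>i. i \<in> T \<Longrightarrow> \<eta> * card W \<le> card {w \<in> W. R w i}"
  shows "\<exists>w\<in>W. \<eta> * card T \<le> card {i \<in> T. R w i}"
proof (rule ccontr)
  assume "\<not> ?thesis"
  then have "(\<Sum>w\<in>W. real (card {i \<in> T. R w i})) < (\<Sum>w\<in>W. \<eta> * card T)"
    using assms by (intro sum_strict_mono) (auto simp: not_le)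
  also have "\<dots> = (\<Sum>i\<in>T. \<eta> * card W)"
    by simp
  also have "\<dots> \<le> (\<Sum>i\<in>T. real (card {w \<in> W. R w i}))"
    by (intro sum_mono many)
  also have "\<dots> = (\<Sum>w\<in>W. real (card {i \<in> T. R w i}))"
    using sum_multicount_gen[of T W "\<lambda>i w. R w i" "\<lambda>w. card {i \<in> T. R w i}"] assms(1,2)
    by (simp flip: of_nat_sum)
  finally show False
    by simp
qed

text \<open>The thinning, by induction on \<open>n\<close>: choose \<open>w\<close> for the largest
  index, keep only the indices it is good for, and recurse there. Density is demanded for all
  \<open>T\<close>, not just the full set below \<open>k\<close>, so that it survives the
  thinning.\<close>

lemma ex_homogeneous_subset:
  fixes \<eta> :: real
  assumes "\<eta> > 0"
  shows "\<exists>M. \<forall>S (W :: nat \<Rightarrow> 'w set) Q. finite S \<longrightarrow> M \<le> card S \<longrightarrow>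
           (\<forall>k\<in>S. \<forall>T\<subseteq>{i \<in> S. i < k}. \<exists>w\<in>W k. \<eta> * card T \<le> card {i \<in> T. Q k w i}) \<longrightarrow>
           (\<exists>K\<subseteq>S. \<exists>w. card K = n \<and> (\<forall>k\<in>K. w k \<in> W k \<and> (\<forall>i\<in>K. i < k \<longrightarrow> Q k (w k) i)))"
proof (induction n)
  case 0
  show ?case
    by (intro exI[of _ 0]) auto
next
  case (Suc n)
  then obtain M where M: "\<forall>S (W :: nat \<Rightarrow> 'w set) Q. finite S \<longrightarrow> M \<le> card S \<longrightarrow>
      (\<forall>k\<in>S. \<forall>T\<subseteq>{i \<in> S. i < k}. \<exists>w\<in>W k. \<eta> * card T \<le> card {i \<in> T. Q k w i}) \<longrightarrow>
      (\<exists>K\<subseteq>S. \<exists>w. card K = n \<and> (\<forall>k\<in>K. w k \<in> W k \<and> (\<forall>i\<in>K. i < k \<longrightarrow> Q k (w k) i)))" ..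
  show ?case
  \<comment> \<open>One index is set aside as the maximum; of the remaining
    \<open>M / \<eta>\<close> or more, an \<open>\<eta>\<close>-fraction still has at least
    \<open>M\<close> elements.\<close>
  proof (intro exI[of _ "nat \<lceil>M / \<eta>\<rceil> + 1"] allI impI)
    fix S and W :: "nat \<Rightarrow> 'w set" and Q
    assume S: "finite S" "nat \<lceil>M / \<eta>\<rceil> + 1 \<le> card S"
      and dense: "\<forall>k\<in>S. \<forall>T\<subseteq>{i \<in> S. i < k}. \<exists>w\<in>W k. \<eta> * card T \<le> card {i \<in> T. Q k w i}"
    define k where "k = Max S"
    have "S \<noteq> {}"
      using S by auto
    then have k: "k \<in> S" "\<And>i. i \<in> S \<Longrightarrow> i \<le> k"
      using S by (auto simp: k_def)
    then have "S - {k} \<subseteq> {i \<in> S. i < k}"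
      by (auto simp: le_neq_implies_less)
    then obtain v where v: "v \<in> W k" "\<eta> * card (S - {k}) \<le> card {i \<in> S - {k}. Q k v i}"
      using dense k(1) by blast
    let ?S = "{i \<in> S - {k}. Q k v i}"
    have "M / \<eta> \<le> card (S - {k})"
      using S k(1) by simp linarith
    then have "M \<le> \<eta> * card (S - {k})"
      using \<open>\<eta> > 0\<close> by (simp add: field_simps)
    then have "M \<le> card ?S"
      using v(2) by linarith
    moreover have "\<forall>k\<in>?S. \<forall>T\<subseteq>{i \<in> ?S. i < k}. \<exists>w\<in>W k. \<eta> * card T \<le> card {i \<in> T. Q k w i}"
    proof (intro ballI allI impI)
      fix l T
      assume "l \<in> ?S" "T \<subseteq> {i \<in> ?S. i < l}"
      then have "l \<in> S" "T \<subseteq> {i \<in> S. i < l}"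
        by auto
      then show "\<exists>w\<in>W l. \<eta> * card T \<le> card {i \<in> T. Q l w i}"
        using dense by blast
    qed
    ultimately obtain K w where K: "K \<subseteq> ?S" "card K = n"
      and w: "\<forall>k\<in>K. w k \<in> W k \<and> (\<forall>i\<in>K. i < k \<longrightarrow> Q k (w k) i)"
      using M[THEN spec[of _ ?S], THEN spec[of _ W], THEN spec[of _ Q]] S(1) by auto
    have "finite K" "k \<notin> K"
      using K S(1) by (auto intro: finite_subset)
    \<comment> \<open>Since \<open>k\<close> is the maximum, it occurs only as the larger index of a
      pair, where membership in \<open>?S\<close> supplies \<open>Q\<close>.\<close>
    have "Q l ((w(k := v)) l) i" if "l \<in> insert k K" "i \<in> insert k K" "i < l" for l i
    proof (cases "l = k")
      case True
      then show ?thesis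
        using that K(1) by auto
    next
      case False
      then have "l \<in> K" "i \<noteq> k"
        using that K(1) k(2) by force+
      then show ?thesis
        using that w False by auto
    qed
    moreover have "card (insert k K) = Suc n" "insert k K \<subseteq> S"
      using K k(1) \<open>finite K\<close> \<open>k \<notin> K\<close> by auto
    moreover have "\<forall>l\<in>insert k K. (w(k := v)) l \<in> W l"
      using w v(1) by auto
    ultimately show "\<exists>K\<subseteq>S. \<exists>w. card K = Suc n \<and>
        (\<forall>k\<in>K. w k \<in> W k \<and> (\<forall>i\<in>K. i < k \<longrightarrow> Q k (w k) i))"
      by blast
  qed
qed

text \<open>Applied with \<open>A\<close> the neighbourhood of \<open>y k\<close> in a class of size
  \<open>p\<close> and \<open>g\<close> the degree into a class of size \<open>q\<close>. The light
  \<open>x\<close> contribute at most about \<open>a * (1 - a) * p * q\<close>, hence about a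
  quarter of \<open>p * q\<close>; the excess must come from heavy ones, each worth at most
  \<open>q\<close>.\<close>

lemma card_heavy_gt:
  fixes \<xi> a :: real and p q :: nat
  assumes "finite A" "0 \<le> a" "a \<le> 1" "\<xi> > 0" "q > 0"
    and le: "\<And>x. x \<in> A \<Longrightarrow> g x \<le> q"
    and small: "real (card A) \<le> (a + \<xi> / 2) * p"
    and large: "real (\<Sum>x\<in>A. g x) > (1/4 + \<xi>) * p * q"
  shows "card {x \<in> A. g x > (1 - a) * q} > \<xi> / 2 * p"
proof -
  let ?B = "{x \<in> A. g x > (1 - a) * q}"
  have "real (\<Sum>x\<in>A. g x) \<le> (\<Sum>x\<in>A. (1 - a) * q + (if g x > (1 - a) * q then real q else 0))"
    unfolding of_nat_sum using le \<open>a \<le> 1\<close> by (intro sum_mono) (auto simp: not_less add_increasing)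
  also have "\<dots> = card A * ((1 - a) * q) + card ?B * real q"
    using \<open>finite A\<close> by (simp add: sum.distrib sum.If_cases Int_def)
  also have "\<dots> \<le> (a + \<xi> / 2) * p * ((1 - a) * q) + card ?B * real q"
    using small \<open>a \<le> 1\<close> by (intro add_right_mono mult_right_mono) auto
  finally have "q * ((1/4 + \<xi>) * p) < q * ((a + \<xi> / 2) * p * (1 - a) + card ?B)"
    using large by (simp add: algebra_simps)
  then have "(1/4 + \<xi>) * p < (a + \<xi> / 2) * (1 - a) * p + card ?B"
    using \<open>q > 0\<close> by (simp add: mult.commute mult.left_commute)
  moreover have "(a + \<xi> / 2) * (1 - a) \<le> 1/4 + \<xi> / 2"
  proof -
    \<comment> \<open>\<open>a * (1 - a)\<close> is 1/4 minus this square, and the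
      \<open>\<xi>\<close>-terms are \<open>\<xi> / 2 - \<xi> * a / 2\<close>.\<close>
    have "0 \<le> (a - 1/2)\<^sup>2" "0 \<le> \<xi> * a"
      using assms by auto
    then show ?thesis
      by (simp add: power2_eq_square field_simps)
  qed
  then have "(a + \<xi> / 2) * (1 - a) * p \<le> (1/4 + \<xi> / 2) * p"
    by (rule mult_right_mono) simp
  ultimately show ?thesis
    by (simp add: algebra_simps)
qed

lemma nbhd_bipartite_between:
  assumes "X \<inter> Y = {}"
  shows "y \<in> Y \<Longrightarrow> nbhd (bipartite_between G X Y) y = nbhd G y \<inter> X"
    and "x \<in> X \<Longrightarrow> nbhd (bipartite_between G X Y) x = nbhd G x \<inter> Y"
  using assms by (auto simp: nbhd_def bipartite_between_def)

lemma two_edge_walks_bipartite_between: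
  assumes "X \<inter> Y = {}" "y \<in> Y"
  shows "two_edge_walks (bipartite_between G X Y) y = (\<Sum>x\<in>nbhd G y \<inter> X. card (nbhd G x \<inter> Y))"
  using assms
  by (auto simp: two_edge_walks_def nbhd_bipartite_between degree_eq_card_nbhd intro!: sum.cong)

lemma homogeneous_family_has_triangle:
  fixes G :: "'a pair_pre_digraph" and C c :: nat and V :: "nat \<Rightarrow> 'a set"
  assumes "\<xi> > 0" "C \<ge> 2 / \<xi>"
    and fin: "\<And>i. i \<in> K \<Longrightarrow> finite (V i)" and ne: "\<And>i. i \<in> K \<Longrightarrow> V i \<noteq> {}"
    and K: "finite K" "card K > 2 / \<xi> + 1"
    and walks: "\<And>i k. i \<in> K \<Longrightarrow> k \<in> K \<Longrightarrow> i < k \<Longrightarrow>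
       real (\<Sum>x\<in>nbhd G (y k) \<inter> V i. card (nbhd G x \<inter> V k)) > (1/4 + \<xi>) * card (V i) * card (V k)"
    and colour: "\<And>i k. i \<in> K \<Longrightarrow> k \<in> K \<Longrightarrow> i < k \<Longrightarrow>
       C * card (nbhd G (y k) \<inter> V i) div card (V i) = c"
  shows "has_triangle G"
proof (rule ccontr)
  assume no_triangle: "\<not> has_triangle G"
  define a where "a = real c / C"
  define i where "i = Min K"
  define B where "B j = {x \<in> nbhd G (y j) \<inter> V i. card (nbhd G x \<inter> V j) > (1 - a) * card (V j)}" for j
  have "0 < 2 / \<xi>"
    using \<open>\<xi> > 0\<close> by simp
  then have "C > 0" "card K > 1"
    using assms(2) K(2) by linarith+
  then have "K \<noteq> {}"
    by auto
  then have i: "i \<in> K" "\<And>j. j \<in> K - {i} \<Longrightarrow> i < j"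
    using K(1) by (auto simp: i_def Min_less_iff le_neq_implies_less)
  have pos: "card (V j) > 0" if "j \<in> K" for j
    using fin ne that by (simp add: card_gt_0_iff)
  \<comment> \<open>Colour \<open>c\<close> puts the relative degree between \<open>a\<close> and
    \<open>a + 1 / C\<close>, and the choice of \<open>C\<close> makes this rounding error at most
    \<open>\<xi> / 2\<close>.\<close>
  have deg_lower: "a * card (V j) \<le> card (nbhd G (y k) \<inter> V j)"
    and deg_upper: "card (nbhd G (y k) \<inter> V j) \<le> (a + \<xi> / 2) * card (V j)"
    if "j \<in> K" "k \<in> K" "j < k" for j k
  proof -
    let ?d = "card (nbhd G (y k) \<inter> V j)" and ?p = "card (V j)"
    have "c * ?p \<le> C * ?d"
      using colour[OF that] div_times_less_eq_dividend[of "C * ?d" ?p] by simp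
    then have "real (c * ?p) \<le> real (C * ?d)"
      by (simp only: of_nat_le_iff)
    then show "a * ?p \<le> ?d"
      using \<open>C > 0\<close> by (simp add: a_def field_simps)
    have "C * ?d < (c + 1) * ?p"
      using colour[OF that] dividend_less_div_times[OF pos[OF \<open>j \<in> K\<close>], of "C * ?d"] by simp
    then have "real (C * ?d) < real ((c + 1) * ?p)"
      by (simp only: of_nat_less_iff)
    then have "?d \<le> (a + 1 / C) * ?p"
      using \<open>C > 0\<close> by (simp add: a_def field_simps)
    also have "\<dots> \<le> (a + \<xi> / 2) * ?p"
      using assms(1,2) \<open>C > 0\<close> by (intro mult_right_mono) (auto simp: field_simps)
    finally show "?d \<le> (a + \<xi> / 2) * ?p" .
  qed
  \<comment> \<open>A second index makes \<open>a\<close> a lower bound for an actual relative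
    degree, which gives \<open>a \<le> 1\<close>.\<close>
  have "K - {i} \<noteq> {}"
    using \<open>card K > 1\<close> i(1) K(1) card_Diff_singleton[of i K] by (intro notI) simp
  then obtain j where j: "j \<in> K - {i}"
    by blast
  have "card (nbhd G (y j) \<inter> V i) \<le> card (V i)"
    using fin[OF i(1)] by (intro card_mono) auto
  then have "a * card (V i) \<le> 1 * real (card (V i))"
    using deg_lower[of i j] i j by auto
  then have "a \<le> 1"
    using pos[OF i(1)] by (simp only: mult_le_cancel_right_pos of_nat_0_less_iff)
  have "0 \<le> a"
    by (simp add: a_def)
  have large: "\<xi> / 2 * card (V i) < card (B j)" if "j \<in> K - {i}" for j
    unfolding B_def
    using that i fin pos deg_upper walks \<open>0 \<le> a\<close> \<open>a \<le> 1\<close> \<open>\<xi> > 0\<close>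
    by (intro card_heavy_gt) (auto intro: card_mono)
  have disj: "B j \<inter> B k = {}" if "j \<in> K" "k \<in> K" "j < k" for j k
  proof (rule ccontr)
    assume "B j \<inter> B k \<noteq> {}"
    then obtain x where x: "x \<in> nbhd G (y k)" "card (nbhd G x \<inter> V j) > (1 - a) * card (V j)"
      by (auto simp: B_def)
    \<comment> \<open>A common neighbour of \<open>x\<close> and \<open>y k\<close> would close a
      triangle on the edge between them.\<close>
    have "(nbhd G x \<inter> V j) \<inter> (nbhd G (y k) \<inter> V j) = {}"
      using no_triangle x(1) unfolding has_triangle_def nbhd_def by blast
    then have "card (nbhd G x \<inter> V j) + card (nbhd G (y k) \<inter> V j)
        = card ((nbhd G x \<inter> V j) \<union> (nbhd G (y k) \<inter> V j))"
      using fin[OF \<open>j \<in> K\<close>] by (simp add: card_Un_disjoint)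
    also have "\<dots> \<le> card (V j)"
      using fin[OF \<open>j \<in> K\<close>] by (intro card_mono) auto
    finally show False
      using x(2) deg_lower[OF that] by (simp add: algebra_simps)
  qed
  \<comment> \<open>More than \<open>2 / \<xi>\<close> disjoint sets, each exceeding a
    \<open>\<xi> / 2\<close> fraction of \<open>V i\<close>, do not fit into
    \<open>V i\<close>.\<close>
  have "1 < real (card K - 1) * (\<xi> / 2)"
    using K(2) \<open>\<xi> > 0\<close> \<open>card K > 1\<close> by (simp add: of_nat_diff field_simps)
  then have "1 * real (card (V i)) < real (card K - 1) * (\<xi> / 2) * card (V i)"
    using pos[OF i(1)] by (intro mult_strict_right_mono) (assumption, simp)
  also have "\<dots> = (\<Sum>j\<in>K - {i}. \<xi> / 2 * card (V i))"
    using i(1) K(1) by simp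
  also have "\<dots> \<le> (\<Sum>j\<in>K - {i}. real (card (B j)))"
    using large by (intro sum_mono less_imp_le)
  also have "\<dots> = card (\<Union>j\<in>K - {i}. B j)"
    unfolding of_nat_sum[symmetric] of_nat_eq_iff
  proof (intro card_UN_disjoint[symmetric] ballI impI)
    fix j k
    assume "j \<in> K - {i}" "k \<in> K - {i}" "j \<noteq> k"
    then show "B j \<inter> B k = {}"
      using disj[of j k] disj[of k j] by (cases j k rule: linorder_cases) auto
  qed (use K(1) fin[OF i(1)] in \<open>auto simp: B_def\<close>)
  also have "\<dots> \<le> card (V i)"
    using fin[OF i(1)] by (intro of_nat_mono card_mono) (auto simp: B_def)
  finally show False
    by simp
qed

theorem theorem5p3:
  fixes \<xi> :: real
  assumes "\<xi> > 0"
  shows "\<exists>m\<^sub>0::nat. \<forall>m\<ge>m\<^sub>0. \<forall>(G :: 'a pair_pre_digraph) (V :: nat \<Rightarrow> 'a set).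
           pair_graph G \<longrightarrow> multipartite m G V \<longrightarrow> (\<forall>i\<in>{1..m}. V i \<noteq> {}) \<longrightarrow>
           (\<forall>i j. 1 \<le> i \<and> i < j \<and> j \<le> m \<longrightarrow>
              rich \<xi> (bipartite_between G (V i) (V j)) (V i) (V j)) \<longrightarrow>
           has_triangle G"
proof -
  \<comment> \<open>Relative degrees are rounded down to multiples of \<open>1 / C\<close>, giving
    \<open>C + 1\<close> colours. Prescribing the colour in advance costs a factor
    \<open>C + 1\<close> in density, hence \<open>\<eta>\<close>; \<open>N\<close> exceeds
    \<open>2 / \<xi> + 1\<close>.\<close>
  define C where "C = nat \<lceil>2 / \<xi>\<rceil>"
  define N where "N = C + 2"
  define \<eta> where "\<eta> = \<xi> / (C + 1)"
  have "\<eta> > 0" "C \<ge> 2 / \<xi>"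
    using assms by (simp add: \<eta>_def add_nonneg_pos, simp add: C_def real_nat_ceiling_ge)
  obtain M where M: "\<forall>S (W :: nat \<Rightarrow> ('a \<times> nat) set) Q. finite S \<longrightarrow> M \<le> card S \<longrightarrow>
      (\<forall>k\<in>S. \<forall>T\<subseteq>{i \<in> S. i < k}. \<exists>w\<in>W k. \<eta> * card T \<le> card {i \<in> T. Q k w i}) \<longrightarrow>
      (\<exists>K\<subseteq>S. \<exists>w. card K = N * (C + 1) \<and> (\<forall>k\<in>K. w k \<in> W k \<and> (\<forall>i\<in>K. i < k \<longrightarrow> Q k (w k) i)))"
    using ex_homogeneous_subset[OF \<open>\<eta> > 0\<close>] ..
  show ?thesis
  proof (intro exI[of _ M] allI impI)
    fix m and G :: "'a pair_pre_digraph" and V :: "nat \<Rightarrow> 'a set"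
    assume m: "M \<le> m" and "pair_graph G" and mp: "multipartite m G V"
      and ne: "\<forall>i\<in>{1..m}. V i \<noteq> {}"
      and rich: "\<forall>i j. 1 \<le> i \<and> i < j \<and> j \<le> m \<longrightarrow>
        rich \<xi> (bipartite_between G (V i) (V j)) (V i) (V j)"
    interpret pair_graph G by fact
    have fin: "finite (V i)" if "i \<in> {1..m}" for i
      by (rule finite_subset[OF _ pair_finite_verts]) (use mp that in \<open>auto simp: multipartite_def\<close>)
    have disj: "V i \<inter> V j = {}" if "i \<in> {1..m}" "j \<in> {1..m}" "i \<noteq> j" for i j
      using mp that by (auto simp: multipartite_def disjoint_family_on_def)
    define many_walks where "many_walks k y i \<longleftrightarrow>
      real (\<Sum>x\<in>nbhd G y \<inter> V i. card (nbhd G x \<inter> V k)) > (1/4 + \<xi>) * card (V i) * card (V k)" for k y i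
    define colour where "colour y i = C * card (nbhd G y \<inter> V i) div card (V i)" for y i
    \<comment> \<open>The second component of \<open>w\<close> prescribes a colour, so one choice of
      \<open>w\<close> fixes the vertex and its rounded degree into all surviving classes at
      once.\<close>
    define Q where "Q k w i \<longleftrightarrow> many_walks k (fst w) i \<and> colour (fst w) i = snd w" for k w i
    have colour_le: "colour y i \<le> C" if "i \<in> {1..m}" for y i
    proof -
      have "C * card (nbhd G y \<inter> V i) \<le> C * card (V i)"
        using fin[OF that] by (intro mult_le_mono2 card_mono) auto
      then have "colour y i \<le> C * card (V i) div card (V i)"
        unfolding colour_def by (rule div_le_mono)
      then show ?thesis
        \<comment> \<open>Division by zero yields 0, so the bound holds in that case too.\<close>
        by (cases "card (V i) = 0") auto
    qed
    have many: "\<eta> * card (V k \<times> {..C}) \<le> card {w \<in> V k \<times> {..C}. Q k w i}"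
      if "i \<in> {1..m}" "k \<in> {1..m}" "i < k" for i k
    proof -
      have "\<eta> * card (V k \<times> {..C}) = \<xi> * card (V k)"
        by (simp add: \<eta>_def card_cartesian_product field_simps)
      \<comment> \<open>Richness speaks about the second class of the ordered pair, so the walks
        start at the larger index.\<close>
      also have "\<xi> * card (V k) < card {y \<in> V k. many_walks k y i}"
        using rich[rule_format, of i k] that disj[OF that(1,2)]
        by (simp add: rich_def poor_def many_walks_def two_edge_walks_bipartite_between not_le
            cong: conj_cong)
      also have "card {y \<in> V k. many_walks k y i} \<le> card {w \<in> V k \<times> {..C}. Q k w i}"
        using fin[OF that(2)] colour_le[OF that(1)]
        by (intro card_inj_on_le[of "\<lambda>y. (y, colour y i)"]) (auto simp: inj_on_def Q_def)
      finally show ?thesis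
        by simp
    qed
    have "\<exists>w\<in>V k \<times> {..C}. \<eta> * card T \<le> card {i \<in> T. Q k w i}"
      if "k \<in> {1..m}" "T \<subseteq> {i \<in> {1..m}. i < k}" for k T
      using that fin ne many
      by (intro ex_element_in_many_sets) (auto intro: finite_subset[OF that(2)] dest!: subsetD)
    then obtain K w where K: "K \<subseteq> {1..m}" "card K = N * (C + 1)"
      and w: "\<forall>k\<in>K. w k \<in> V k \<times> {..C} \<and> (\<forall>i\<in>K. i < k \<longrightarrow> Q k (w k) i)"
      using M[THEN spec[of _ "{1..m}"], THEN spec[of _ "\<lambda>k. V k \<times> {..C}"], THEN spec[of _ Q]] m
      by auto
    have "finite K"
      using K(1) by (rule finite_subset) simp
    have "(\<lambda>k. snd (w k)) \<in> K \<rightarrow> {..C}"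
      using w by fastforce
    \<comment> \<open>The prescribed colour may still vary with \<open>k\<close>; among
      \<open>N * (C + 1)\<close> indices some colour occurs at least \<open>N\<close> times.\<close>
    then obtain c where "card K \<le> card ((\<lambda>k. snd (w k)) -` {c} \<inter> K) * card {..C}"
      using pigeonhole_card[of "\<lambda>k. snd (w k)" K "{..C}"] \<open>finite K\<close> by auto
    moreover define L where "L = (\<lambda>k. snd (w k)) -` {c} \<inter> K"
    ultimately have "N \<le> card L"
      using K(2) by (simp del: mult_Suc_right)
    moreover have "2 / \<xi> + 1 < N"
      using \<open>C \<ge> 2 / \<xi>\<close> by (simp add: N_def)
    ultimately have L: "2 / \<xi> + 1 < card L"
      by linarith
    have L_sub: "i \<in> {1..m}" if "i \<in> L" for i
      using K(1) that by (auto simp: L_def)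
    have "many_walks k (fst (w k)) i" "colour (fst (w k)) i = c" if "i \<in> L" "k \<in> L" "i < k" for i k
      using w that by (auto simp: Q_def L_def)
    then show "has_triangle G"
      using assms \<open>C \<ge> 2 / \<xi>\<close> fin[OF L_sub] bspec[OF ne L_sub] \<open>finite K\<close> L
      unfolding many_walks_def colour_def
      by (intro homogeneous_family_has_triangle[where y = "\<lambda>k. fst (w k)" and c = c and K = L and V = V])
        (auto simp: L_def)
  qed
qed

end
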